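(* Let $R_{-1+1}(\cdot)$ denote the escape rate from the left well to the right well and $R_{+1-1}(\cdot)$ the escape rate from the right well to the left well. Let $u$ be the time coordinate of entry into a well. Then the probability density functions for the escape occurring at time coordinate $t>u$ are $$p_-(t,u)=R_{-1+1}(t)\exp\left\{-\int_u^t R_{-1+1}(s)\,ds\right\},$$ $$p_+(t,u)=R_{+1-1}(t)\exp\left\{-\int_u^t R_{+1-1}(s)\,ds\right\},$$ where $p_-(t,u)$ is for escape from left to right and $p_+(t,u)$ is for escape from right to left.
   Context: A particle moves in a periodically forced potential on $\mathbb{R}^r$ with two wells under small noise, following $dX_t=(-\nabla V(X_t)+F\cos(\Omega t))\,dt+\epsilon\,dW_t$ with $W_t$ a Wiener process. The wells are called left (labelled $-1$) and right (labelled $+1$), and the particle makes transitions between them. The time-dependent escape rates are used in the following informal sense: for a particle in the left well, the probability of escape in a very small time interval $[t,t+\delta t]$ is $1-e^{-R_{-1+1}(t)\,\delta t}\approx R_{-1+1}(t)\,\delta t$, and the probability of staying is $e^{-R_{-1+1}(t)\,\delta t}$; similarly for the right well with $R_{+1-1}$. *)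

theory Defs
  imports "HOL-Probability.Probability" "HOL-Library.Landau_Symbols"
begin

text \<open>
  The motion of the particle enters only through the label \<open>Y t \<omega>\<close> of the well it occupies at time
  \<open>t\<close>: \<open>- 1\<close> for the left and \<open>1\<close> for the right well. \<open>M\<close> is the law of the particle
  from its entry into well \<open>i\<close> at time \<open>u\<close> onwards. Nothing else is assumed about \<open>Y\<close>; in particular it
  need not be Markov, and it may be any such labelling of the path of the diffusion
  \<open>dX = (- \<nabla>V(X) + F cos(\<Omega> t)) dt + \<epsilon> dW\<close>. The requirement that a label persists for a
  short while makes "entry into a well" meaningful: the particle does not leave at the very
  instant at which it enters.
\<close>

definition enters_well :: "'a measure \<Rightarrow> (real \<Rightarrow> 'a \<Rightarrow> int) \<Rightarrow> int \<Rightarrow> real \<Rightarrow> bool" where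
  "enters_well M Y i u \<longleftrightarrow>
     prob_space M \<and>
     (\<forall>t\<ge>u. Y t \<in> measurable M (count_space UNIV)) \<and>
     (\<forall>\<omega>\<in>space M. \<forall>t\<ge>u. Y t \<omega> \<in> {-1, 1} \<and> (\<forall>\<^sub>F s in at_right t. Y s \<omega> = Y t \<omega>)) \<and>
     (AE \<omega> in M. Y u \<omega> = i)"

text \<open>
  Time of the first transition to well \<open>j\<close> after time \<open>u\<close>; it is \<open>\<infinity>\<close> if there is none.
\<close>

definition escape_time :: "(real \<Rightarrow> 'a \<Rightarrow> int) \<Rightarrow> int \<Rightarrow> real \<Rightarrow> 'a \<Rightarrow> ereal" where
  "escape_time Y j u \<omega> = Inf (ereal ` {t. u < t \<and> Y t \<omega> = j})"

text \<open>
  \<open>R\<close> is the rate of escape to well \<open>j\<close>: given that the particle has not escaped before time \<open>t\<close>,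
  it escapes during \<open>[t, t + h]\<close> with probability \<open>1 - exp (- R t * h)\<close> up to \<open>o(h)\<close>. The
  conditioning event is \<open>t \<le> T\<close> and the interval is closed, so an escape at exactly \<open>t\<close> counts;
  with \<open>t < T\<close> instead, atoms of the law of \<open>T\<close> would go unnoticed. Local
  integrability gives the integral of \<open>R\<close> a meaning.
\<close>

definition has_escape_rate ::
  "'a measure \<Rightarrow> (real \<Rightarrow> 'a \<Rightarrow> int) \<Rightarrow> int \<Rightarrow> real \<Rightarrow> (real \<Rightarrow> real) \<Rightarrow> bool" where
  "has_escape_rate M Y j u R \<longleftrightarrow>
     (\<forall>t\<ge>u. set_integrable lborel {u..t} R) \<and>
     (\<forall>t\<ge>u. \<P>(\<omega> in M. ereal t \<le> escape_time Y j u \<omega>) > 0 \<longrightarrow>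
        (\<lambda>h. \<P>(\<omega> in M. escape_time Y j u \<omega> \<in> {ereal t .. ereal (t + h)} \<bar>
                       ereal t \<le> escape_time Y j u \<omega>)
             - (1 - exp (- R t * h))) \<in> o[at_right 0](\<lambda>h. h))"

text \<open>
  \<open>p\<close> is the density of the escape time on \<open>(u, \<infinity>)\<close>. If escape is not certain, this density has total
  mass below 1, the missing mass sitting at \<open>\<infinity>\<close>; if it is certain, \<open>p\<close> is the
  probability density of the real-valued escape time.
\<close>

definition escape_time_density ::
  "'a measure \<Rightarrow> (real \<Rightarrow> 'a \<Rightarrow> int) \<Rightarrow> int \<Rightarrow> real \<Rightarrow> (real \<Rightarrow> real) \<Rightarrow> bool" where
  "escape_time_density M Y j u p \<longleftrightarrow>
     set_borel_measurable lborel {u<..} p \<and>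
     (\<forall>t>u. 0 \<le> p t) \<and>
     escape_time Y j u \<in> borel_measurable M \<and>
     (\<forall>A\<in>sets borel. A \<subseteq> {u<..} \<longrightarrow>
        emeasure M {\<omega>\<in>space M. escape_time Y j u \<omega> \<in> ereal ` A} = (\<integral>\<^sup>+t\<in>A. ennreal (p t) \<partial>lborel)) \<and>
     ((AE \<omega> in M. escape_time Y j u \<omega> < \<infinity>) \<longrightarrow>
        distributed M lborel (\<lambda>\<omega>. real_of_ereal (escape_time Y j u \<omega>))
          (\<lambda>t. ennreal (indicator {u<..} t * p t)))"

end

theory Submission
  imports Defs
begin

text \<open>
  Let \<open>S t\<close> be the probability that the particle has not escaped up to time \<open>t\<close>. The rate condition excludes
  atoms of the escape time and says that \<open>S\<close> has the right derivative \<open>- R t * S t\<close> at every \<open>t \<ge> u\<close>. Since \<open>R\<close>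
  is merely Lebesgue integrable, this is integrated by a one-sided fundamental theorem of calculus:
  a continuous function with a finite right derivative everywhere is the integral of that derivative as soon as
  the derivative is integrable. Applied to \<open>ln S\<close> it gives \<open>S t = exp (- \<integral>\<^sub>u\<^sup>t R)\<close>, first
  up to a possible zero of \<open>S\<close>; integrability of \<open>R\<close> keeps \<open>S\<close> bounded away from \<open>0\<close> there, so that no zero exists.
  Applied to \<open>S\<close> itself, it shows that the law of the escape time has density \<open>R S\<close>.
\<close>

section \<open>One-sided fundamental theorem of calculus\<close>

text \<open>Continuation from the left end: if a slightly enlarged bound holds at some
  \<open>s < b\<close>, the right derivative at \<open>s\<close> carries it further. Nonnegativity
  of \<open>g\<close> lets the bound at \<open>t\<close> be a measure of \<open>{a..t}\<close>,
  which increases with \<open>t\<close>; the slack \<open>e\<close> is removed at the end.\<close>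

lemma right_derivative_le_integral_nonneg:
  fixes H D g :: "real \<Rightarrow> real"
  assumes ab: "a \<le> b" and cont: "continuous_on {a..b} H"
    and deriv: "\<And>x. a \<le> x \<Longrightarrow> x < b \<Longrightarrow> (H has_real_derivative D x) (at_right x)"
    and le: "\<And>x. a \<le> x \<Longrightarrow> x < b \<Longrightarrow> D x \<le> g x"
    and nonneg: "\<And>x. x \<in> {a..b} \<Longrightarrow> 0 \<le> g x"
    and int: "set_integrable lborel {a..b} g"
  shows "H b - H a \<le> (LBINT x:{a..b}. g x)"
proof -
  define I where "I = (LBINT x:{a..b}. g x)"
  have bound: "H b - H a \<le> I + 2 * e * (b - a) + 2 * e" if e: "e > 0" for e :: real
  proof -
    \<comment> \<open>Set integrability yields Borel measurability of this extension by zero, not of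
      \<open>g\<close>.\<close>
    define g0 where "g0 x = indicator {a..b} x * g x" for x
    have g0_meas [measurable]: "g0 \<in> borel_measurable borel"
      using int by (simp add: set_integrable_def g0_def [abs_def] borel_measurable_integrable)
    have g0_int: "integrable lborel g0"
      using int by (simp add: set_integrable_def g0_def [abs_def])
    have g0_nonneg: "0 \<le> g0 x" for x
      using nonneg by (auto simp: g0_def indicator_def)
    have nn_g0: "(\<integral>\<^sup>+x. ennreal (g0 x) \<partial>lborel) = ennreal I"
      using nn_integral_eq_integral[OF g0_int] g0_nonneg
      by (simp add: I_def set_lebesgue_integral_def g0_def [abs_def])
    have I_nonneg: "0 \<le> I"
      unfolding I_def set_lebesgue_integral_def using nonneg
      by (intro integral_nonneg_AE AE_I2) (auto simp: indicator_def)
    \<comment> \<open>In the spirit of Vitali-Caratheodory, \<open>W\<close> below is a lower semicontinuous function lying strictly above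
      \<open>g\<close>, with almost the same integral. Near each \<open>s\<close> it exceeds \<open>D s\<close>, so the set \<open>S\<close> of points up
      to which the claim holds with \<open>W\<close> for \<open>g\<close> extends to the right of each of its points.\<close>
    define E where "E k = {x \<in> {a..b}. real k * e \<le> g0 x \<and> g0 x < (real k + 1) * e}" for k
    have E_sets [measurable]: "E k \<in> sets borel" for k
      unfolding E_def by measurable
    have E_cover: "\<exists>k. x \<in> E k" if "x \<in> {a..b}" for x
    proof -
      define k where "k = nat \<lfloor>g0 x / e\<rfloor>"
      have "real k = of_int \<lfloor>g0 x / e\<rfloor>"
        using g0_nonneg[of x] e by (simp add: k_def)
      then have "real k \<le> g0 x / e" "g0 x / e < real k + 1"
        by linarith+
      then show ?thesis
        using that e by (intro exI[of _ k]) (auto simp: E_def field_simps)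
    qed
    have E_unique: "l = k" if "x \<in> E k" "x \<in> E l" for x k l
    proof -
      have "real k * e < (real l + 1) * e" "real l * e < (real k + 1) * e"
        using that by (auto simp: E_def)
      then have "real k < real l + 1" "real l < real k + 1"
        using e by (auto simp: mult_less_cancel_right)
      then show ?thesis by linarith
    qed
    \<comment> \<open>Chosen so that \<open>c k * d k = e * (1/2) ^ k\<close>: the excess sets
      \<open>U k - E k\<close> then cost at most \<open>2 * e\<close> altogether.\<close>
    define d where "d k = (1/2) ^ k / (real k + 2)" for k :: nat
    have d_pos: "0 < d k" for k by (simp add: d_def)
    have "\<exists>U. open U \<and> E k \<subseteq> U \<and> emeasure lborel (U - E k) < ennreal (d k)" for k
      using outer_regular_lborel[OF E_sets d_pos, of k k] by metis
    then obtain U where U: "\<And>k. open (U k)" "\<And>k. E k \<subseteq> U k"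
        "\<And>k. emeasure lborel (U k - E k) < ennreal (d k)"
      by metis
    have U_sets [measurable]: "U k \<in> sets borel" for k
      using U(1) by (rule borel_open)
    \<comment> \<open>On \<open>E k\<close> this exceeds \<open>g0\<close> by more than
      \<open>e\<close> and by at most \<open>2 * e\<close>.\<close>
    define c where "c k = (real k + 2) * e" for k :: nat
    have c_nonneg: "0 \<le> c k" for k using e by (simp add: c_def)
    define W where "W x = (\<Sum>k. ennreal (c k) * indicator (U k) x)" for x :: real
    have W_meas [measurable]: "W \<in> borel_measurable borel"
      unfolding W_def by measurable
    define Q where "Q = density lborel W"
    have sets_Q [simp, measurable_cong]: "sets Q = sets borel" by (simp add: Q_def)
    have space_Q [simp]: "space Q = UNIV" by (simp add: Q_def)
    have sumE: "(\<Sum>k. ennreal (c k) * indicator (E k) x)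
        \<le> ennreal (g0 x) + ennreal (2 * e) * indicator {a..b} x" for x
    proof (cases "x \<in> {a..b}")
      case True
      then obtain k where k: "x \<in> E k" using E_cover by blast
      have "(\<Sum>l. ennreal (c l) * indicator (E l) x) = (\<Sum>l\<in>{k}. ennreal (c l) * indicator (E l) x)"
        using E_unique[OF k] by (intro suminf_finite) (auto simp: indicator_def)
      also have "\<dots> = ennreal (c k)" using k by simp
      also have "\<dots> \<le> ennreal (g0 x + 2 * e)"
        using k by (intro ennreal_leI) (auto simp: E_def c_def algebra_simps)
      also have "\<dots> = ennreal (g0 x) + ennreal (2 * e) * indicator {a..b} x"
        using True e g0_nonneg by (simp add: ennreal_plus)
      finally show ?thesis .
    next
      case False
      then have "x \<notin> E k" for k by (auto simp: E_def)
      then show ?thesis by simp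
    qed
    \<comment> \<open>The total mass is bounded by three contributions: \<open>I\<close>, then
      \<open>2 * e * (b - a)\<close> for the gap between \<open>c k\<close> and \<open>g0\<close> on
      \<open>{a..b}\<close>, then \<open>2 * e\<close> for the sets
      \<open>U k - E k\<close>.\<close>
    have "emeasure Q UNIV = (\<integral>\<^sup>+x. W x \<partial>lborel)"
      by (simp add: Q_def emeasure_density)
    also have "\<dots> = (\<Sum>k. ennreal (c k) * emeasure lborel (U k))"
      unfolding W_def by (subst nn_integral_suminf) (auto simp: nn_integral_cmult)
    also have "\<dots> \<le> (\<Sum>k. ennreal (c k) * emeasure lborel (E k) + ennreal (e * (1/2) ^ k))"
    proof (intro suminf_le allI summableI)
      fix k
      have "emeasure lborel (U k) = emeasure lborel (E k) + emeasure lborel (U k - E k)"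
        using U(2)[of k] by (subst plus_emeasure) (auto simp: Un_absorb1)
      also have "\<dots> \<le> emeasure lborel (E k) + ennreal (d k)"
        using U(3)[of k] by (intro add_left_mono) simp
      finally have "ennreal (c k) * emeasure lborel (U k)
          \<le> ennreal (c k) * (emeasure lborel (E k) + ennreal (d k))"
        by (rule mult_left_mono) simp
      also have "\<dots> = ennreal (c k) * emeasure lborel (E k) + ennreal (c k * d k)"
        using c_nonneg[of k] d_pos[of k] by (simp add: distrib_left ennreal_mult)
      also have "c k * d k = e * (1/2) ^ k"
        by (simp add: c_def d_def)
      finally show "ennreal (c k) * emeasure lborel (U k)
          \<le> ennreal (c k) * emeasure lborel (E k) + ennreal (e * (1/2) ^ k)" .
    qed
    also have "\<dots> = (\<Sum>k. ennreal (c k) * emeasure lborel (E k)) + (\<Sum>k. ennreal (e * (1/2) ^ k))"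
      by (intro suminf_add[symmetric] summableI)
    also have "(\<Sum>k. ennreal (e * (1/2) ^ k)) = ennreal (2 * e)"
    proof -
      have "(\<lambda>k. e * (1/2) ^ k) sums (e * (1 / (1 - 1/2)))"
        by (intro sums_mult geometric_sums) simp
      then show ?thesis
        using e by (intro suminf_ennreal_eq) (auto simp: mult.commute)
    qed
    also have "(\<Sum>k. ennreal (c k) * emeasure lborel (E k))
        = (\<integral>\<^sup>+x. (\<Sum>k. ennreal (c k) * indicator (E k) x) \<partial>lborel)"
      by (subst nn_integral_suminf) (auto simp: nn_integral_cmult)
    also have "\<dots> \<le> (\<integral>\<^sup>+x. ennreal (g0 x) + ennreal (2 * e) * indicator {a..b} x \<partial>lborel)"
      by (intro nn_integral_mono sumE)
    also have "\<dots> = ennreal I + ennreal (2 * e) * ennreal (b - a)"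
      using ab by (subst nn_integral_add) (auto simp: nn_g0 nn_integral_cmult)
    also have "\<dots> + ennreal (2 * e) = ennreal (I + 2 * e * (b - a) + 2 * e)"
      using I_nonneg e ab by (simp add: ennreal_plus ennreal_mult)
    finally have Q_le: "emeasure Q UNIV \<le> ennreal (I + 2 * e * (b - a) + 2 * e)"
      by (simp add: add_right_mono)
    interpret Q: finite_measure Q
      using Q_le by (intro finite_measureI) (auto simp: top_unique)
    define N where "N t = measure Q {a..t}" for t
    have N_mono: "N s \<le> N t" if "s \<le> t" for s t
      unfolding N_def using that by (intro Q.finite_measure_mono) auto
    define S where "S = {t \<in> {a..b}. H t - H a \<le> N t}"
    have aS: "a \<in> S" using ab by (simp add: S_def N_def)
    have bdd: "bdd_above S" by (auto simp: S_def bdd_above_def)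
    define s where "s = Sup S"
    have s_ab: "a \<le> s" "s \<le> b"
      using cSup_upper[OF aS bdd] aS by (auto simp: s_def S_def intro!: cSup_least)
    have "s \<in> closure S"
      unfolding s_def using aS bdd by (intro closure_contains_Sup) auto
    then obtain x where x: "\<And>n. x n \<in> S" "x \<longlonglongrightarrow> s"
      by (auto simp: closure_sequential)
    \<comment> \<open>The supremum is attained: \<open>H\<close> is continuous, and monotonicity
      gives \<open>N (x n) \<le> N s\<close>.\<close>
    have sS: "s \<in> S"
    proof -
      have "(\<lambda>n. H (x n)) \<longlonglongrightarrow> H s"
        using x s_ab by (intro continuous_on_tendsto_compose[OF cont]) (auto simp: S_def)
      moreover have "H (x n) \<le> H a + N s" for n
      proof -
        have "x n \<le> s" unfolding s_def using x(1) bdd by (rule cSup_upper)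
        then show ?thesis using x(1)[of n] N_mono[of "x n" s] by (auto simp: S_def)
      qed
      ultimately have "H s \<le> H a + N s"
        by (intro LIMSEQ_le_const2) auto
      then show ?thesis using s_ab by (simp add: S_def)
    qed
    have "s = b"
    proof (rule ccontr)
      assume "s \<noteq> b"
      then have sb: "s < b" using s_ab by simp
      obtain k where k: "s \<in> E k" using E_cover s_ab by auto
      have "((\<lambda>y. (H y - H s) / (y - s)) \<longlongrightarrow> D s) (at_right s)"
        using deriv[OF s_ab(1) sb] by (simp add: has_field_derivative_iff)
      moreover have "D s < c k"
        using le[OF s_ab(1) sb] k s_ab e by (auto simp: E_def c_def g0_def algebra_simps)
      ultimately have "\<forall>\<^sub>F y in at_right s. (H y - H s) / (y - s) < c k"
        by (rule order_tendstoD)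
      then obtain y0 where y0: "s < y0" "\<And>y. s < y \<Longrightarrow> y < y0 \<Longrightarrow> (H y - H s) / (y - s) < c k"
        by (auto simp: eventually_at_right_field)
      obtain r where r: "r > 0" "ball s r \<subseteq> U k"
        using U(1)[of k] U(2)[of k] k by (meson open_contains_ball subsetD)
      \<comment> \<open>Here \<open>y0\<close> keeps the difference quotient below
        \<open>c k\<close>, \<open>b\<close> keeps \<open>y\<close> in the interval, and
        \<open>s + r\<close> keeps \<open>{s<..y}\<close> inside \<open>U k\<close>.\<close>
      obtain y where y: "s < y" "y < min (min y0 b) (s + r)"
        using dense[of s "min (min y0 b) (s + r)"] y0 sb r by auto
      have sub: "{s<..y} \<subseteq> U k"
        using r y by (auto simp: dist_real_def)
      have "ennreal (c k * (y - s)) = (\<integral>\<^sup>+x. ennreal (c k) * indicator {s<..y} x \<partial>lborel)"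
        using y c_nonneg[of k] by (subst nn_integral_cmult) (auto simp: ennreal_mult)
      also have "\<dots> \<le> (\<integral>\<^sup>+x. W x * indicator {s<..y} x \<partial>lborel)"
      proof (intro nn_integral_mono)
        fix x
        \<comment> \<open>A single term of the series already bounds \<open>W\<close> from below by
          \<open>c k\<close> on \<open>U k\<close>.\<close>
        have "F k \<le> suminf F" for F :: "nat \<Rightarrow> ennreal"
          using sum_le_suminf[of F "{k}"] by simp
        then have "ennreal (c k) * indicator (U k) x \<le> W x"
          unfolding W_def .
        then show "ennreal (c k) * indicator {s<..y} x \<le> W x * indicator {s<..y} x"
          using sub by (auto simp: indicator_def)
      qed
      also have "\<dots> = emeasure Q {s<..y}"
        by (simp add: Q_def emeasure_density)
      also have "\<dots> = ennreal (measure Q {s<..y})"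
        by (rule Q.emeasure_eq_measure)
      finally have "c k * (y - s) \<le> measure Q {s<..y}"
        by (simp add: ennreal_le_iff)
      moreover have "N y = N s + measure Q {s<..y}"
        unfolding N_def using y s_ab
        by (subst Q.finite_measure_Union[symmetric]) (auto intro!: arg_cong[of _ _ "measure Q"])
      moreover have "H y - H s \<le> c k * (y - s)"
        using y0(2)[of y] y by (simp add: field_simps)
      ultimately have "y \<in> S"
        using sS y by (auto simp: S_def)
      then have "y \<le> s" unfolding s_def using bdd by (rule cSup_upper)
      then show False using y by simp
    qed
    then have "H b - H a \<le> N b" using sS by (simp add: S_def)
    also have "\<dots> \<le> measure Q UNIV"
      unfolding N_def by (intro Q.finite_measure_mono) auto
    also have "\<dots> \<le> I + 2 * e * (b - a) + 2 * e"
    proof -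
      have "0 \<le> I + 2 * e * (b - a) + 2 * e" using I_nonneg e ab by simp
      from Q_le[unfolded Q.emeasure_eq_measure ennreal_le_iff[OF this]] show ?thesis .
    qed
    finally show ?thesis .
  qed
  show ?thesis
  proof (rule ccontr)
    assume "\<not> ?thesis"
    then have pos: "0 < H b - H a - I" by (simp add: I_def)
    \<comment> \<open>With this value the error \<open>2 * e * (b - a) + 2 * e\<close> is half of
      the supposed gap.\<close>
    define e where "e = (H b - H a - I) / (4 * (b - a + 1))"
    have "e > 0" using pos ab by (simp add: e_def)
    from bound[OF this] have "H b - H a - I \<le> 2 * (b - a + 1) * e"
      by (simp add: algebra_simps)
    also have "\<dots> = (H b - H a - I) / 2"
      using ab by (simp add: e_def field_simps)
    finally show False using pos by simp
  qed
qed

lemma right_derivative_le_integral: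
  fixes H D :: "real \<Rightarrow> real"
  assumes ab: "a \<le> b" and cont: "continuous_on {a..b} H"
    and deriv: "\<And>x. a \<le> x \<Longrightarrow> x < b \<Longrightarrow> (H has_real_derivative D x) (at_right x)"
    and int: "set_integrable lborel {a..b} D"
  shows "H b - H a \<le> (LBINT x:{a..b}. D x)"
proof -
  \<comment> \<open>Truncating \<open>D\<close> from below at \<open>- n\<close> and adding \<open>n t\<close> to \<open>H\<close> reduces to a nonnegative majorant.\<close>
  define m where "m n x = max (D x) (- real n)" for n :: nat and x
  have m_eq: "indicator {a..b} x *\<^sub>R m n x
      = max (indicator {a..b} x *\<^sub>R D x) (indicator {a..b} x *\<^sub>R (- real n))" for n x
    by (simp add: m_def indicator_def)
  have const_int: "set_integrable lborel {a..b} (\<lambda>_. c::real)" for c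
    by (intro borel_integrable_atLeastAtMost') simp
  have m_int: "set_integrable lborel {a..b} (m n)" for n
    using int const_int[of "- real n"] unfolding set_integrable_def m_eq
    by (rule Bochner_Integration.integrable_max)
  have le: "H b - H a \<le> (LBINT x:{a..b}. m n x)" for n
  proof -
    have "(H b + real n * b) - (H a + real n * a) \<le> (LBINT x:{a..b}. m n x + real n)"
    proof (rule right_derivative_le_integral_nonneg[OF ab, where D = "\<lambda>x. D x + real n"])
      show "continuous_on {a..b} (\<lambda>x. H x + real n * x)"
        by (intro continuous_intros cont)
      show "set_integrable lborel {a..b} (\<lambda>x. m n x + real n)"
        by (intro set_integral_add m_int const_int)
    qed (auto simp: m_def intro!: derivative_eq_intros deriv)
    also have "\<dots> = (LBINT x:{a..b}. m n x) + (LBINT x:{a..b}. real n)"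
      by (intro set_integral_add m_int const_int)
    also have "(LBINT x:{a..b}. real n) = real n * (b - a)"
      using ab by (simp add: set_lebesgue_integral_def)
    finally show ?thesis by (simp add: algebra_simps)
  qed
  \<comment> \<open>Truncation never increases the absolute value, so \<open>\<bar>D\<bar>\<close>
    dominates; at each point it is inactive for large \<open>n\<close>.\<close>
  have "(\<lambda>n. LBINT x:{a..b}. m n x) \<longlonglongrightarrow> (LBINT x:{a..b}. D x)"
    unfolding set_lebesgue_integral_def
  proof (rule integral_dominated_convergence)
    show "integrable lborel (\<lambda>x. norm (indicator {a..b} x *\<^sub>R D x))"
      using int by (simp add: set_integrable_def)
    show "AE x in lborel. (\<lambda>n. indicator {a..b} x *\<^sub>R m n x) \<longlonglongrightarrow> indicator {a..b} x *\<^sub>R D x"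
    proof (intro AE_I2 tendsto_eventually)
      fix x
      obtain n0 where "- D x \<le> real n0" using real_arch_simple by blast
      then have "m n x = D x" if "n \<ge> n0" for n
        using that by (simp add: m_def)
      then show "\<forall>\<^sub>F n in sequentially. indicator {a..b} x *\<^sub>R m n x = indicator {a..b} x *\<^sub>R D x"
        unfolding eventually_sequentially by metis
    qed
    show "AE x in lborel. norm (indicator {a..b} x *\<^sub>R m n x)
        \<le> norm (indicator {a..b} x *\<^sub>R D x)" for n
      by (intro AE_I2) (auto simp: m_def indicator_def)
  qed (use int m_int in \<open>auto simp: set_integrable_def\<close>)
  then show ?thesis
    by (rule LIMSEQ_le_const) (use le in blast)
qed

text \<open>The reverse inequality is the same bound for \<open>- H\<close> and
  \<open>- D\<close>.\<close>

lemma right_derivative_integral: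
  fixes H D :: "real \<Rightarrow> real"
  assumes ab: "a \<le> b" and cont: "continuous_on {a..b} H"
    and deriv: "\<And>x. a \<le> x \<Longrightarrow> x < b \<Longrightarrow> (H has_real_derivative D x) (at_right x)"
    and int: "set_integrable lborel {a..b} D"
  shows "(LBINT x:{a..b}. D x) = H b - H a"
proof (rule antisym)
  have "(- H b) - (- H a) \<le> (LBINT x:{a..b}. - D x)"
    using ab
  proof (rule right_derivative_le_integral)
    show "set_integrable lborel {a..b} (\<lambda>x. - D x)"
      using int by (simp add: set_integrable_def)
  qed (auto intro!: continuous_intros cont derivative_eq_intros deriv)
  also have "\<dots> = - (LBINT x:{a..b}. D x)"
    by (simp add: set_lebesgue_integral_def)
  finally show "(LBINT x:{a..b}. D x) \<le> H b - H a" by simp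
qed (rule right_derivative_le_integral[OF assms])

section \<open>The law of a random time with a given hazard rate\<close>

text \<open>Isolates what is used of the escape time, so that both directions of escape become
  instances.\<close>

locale hazard_rate = prob_space M for M :: "'a measure" +
  fixes T :: "'a \<Rightarrow> ereal" and u :: real and R :: "real \<Rightarrow> real"
  assumes T_measurable [measurable]: "T \<in> borel_measurable M"
    and T_ge: "\<And>\<omega>. \<omega> \<in> space M \<Longrightarrow> ereal u \<le> T \<omega>"
    and R_integrable: "\<And>t. u \<le> t \<Longrightarrow> set_integrable lborel {u..t} R"
    and rate: "\<And>t. u \<le> t \<Longrightarrow> 0 < \<P>(\<omega> in M. ereal t \<le> T \<omega>) \<Longrightarrow>
      (\<lambda>h. \<P>(\<omega> in M. T \<omega> \<in> {ereal t .. ereal (t + h)} \<bar> ereal t \<le> T \<omega>)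
           - (1 - exp (- R t * h))) \<in> o[at_right 0](\<lambda>h. h)"
begin

text \<open>The restriction drops the event \<open>T = \<infinity>\<close>, which
  \<open>real_of_ereal\<close> would otherwise turn into mass at \<open>0\<close>. The result is a
  measure of total mass at most 1.\<close>

definition law :: "real measure" where
  "law = distr (restrict_space M {\<omega> \<in> space M. T \<omega> < \<infinity>}) borel (\<lambda>\<omega>. real_of_ereal (T \<omega>))"

text \<open>This is the probability of \<open>T > t\<close>; never escaping counts as
  survival.\<close>

definition survival :: "real \<Rightarrow> real" where
  "survival t = 1 - cdf law t"

lemma mem_ereal_image_iff:
  assumes "\<omega> \<in> space M"
  shows "T \<omega> \<in> ereal ` A \<longleftrightarrow> T \<omega> < \<infinity> \<and> real_of_ereal (T \<omega>) \<in> A"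
  using T_ge[OF assms] by (cases "T \<omega>") auto

lemma emeasure_law:
  assumes [measurable]: "A \<in> sets borel"
  shows "emeasure law A = emeasure M {\<omega> \<in> space M. T \<omega> \<in> ereal ` A}"
proof -
  let ?F = "{\<omega> \<in> space M. T \<omega> < \<infinity>}"
  have "emeasure law A
      = emeasure (restrict_space M ?F) ((\<lambda>\<omega>. real_of_ereal (T \<omega>)) -` A \<inter> space (restrict_space M ?F))"
    unfolding law_def by (intro emeasure_distr measurable_restrict_space1) measurable
  also have "(\<lambda>\<omega>. real_of_ereal (T \<omega>)) -` A \<inter> space (restrict_space M ?F)
      = {\<omega> \<in> space M. T \<omega> \<in> ereal ` A}"
    by (auto simp: space_restrict_space mem_ereal_image_iff)
  also have "emeasure (restrict_space M ?F) \<dots> = emeasure M \<dots>"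
    by (intro emeasure_restrict_space) (auto simp: mem_ereal_image_iff)
  finally show ?thesis .
qed

lemma measure_law: "A \<in> sets borel \<Longrightarrow> measure law A = \<P>(\<omega> in M. T \<omega> \<in> ereal ` A)"
  by (simp add: measure_def emeasure_law)

lemma sets_law [simp, measurable_cong]: "sets law = sets borel"
  by (simp add: law_def)

sublocale law: finite_borel_measure law
proof (intro finite_borel_measure.intro finite_measureI finite_borel_measure_axioms.intro)
  have "space law = UNIV" by (simp add: law_def)
  then show "emeasure law (space law) \<noteq> \<infinity>"
    by (simp add: emeasure_law)
qed simp

section \<open>The rate condition as a right derivative of the survival function\<close>

lemma prob_ge: "\<P>(\<omega> in M. ereal t \<le> T \<omega>) = 1 - measure law {..<t}"
proof -
  have "T \<omega> \<in> ereal ` {..<t} \<longleftrightarrow> \<not> ereal t \<le> T \<omega>" if "\<omega> \<in> space M" for \<omega>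
    using T_ge[OF that] by (cases "T \<omega>") auto
  then have "{\<omega> \<in> space M. ereal t \<le> T \<omega>} = space M - {\<omega> \<in> space M. T \<omega> \<in> ereal ` {..<t}}"
    by auto
  moreover have "{\<omega> \<in> space M. T \<omega> \<in> ereal ` {..<t}} \<in> events"
    by (simp add: mem_ereal_image_iff cong: conj_cong)
  ultimately show ?thesis
    by (simp add: prob_compl measure_law)
qed

lemma cond_prob_eq:
  "\<P>(\<omega> in M. T \<omega> \<in> {ereal t .. ereal (t + h)} \<bar> ereal t \<le> T \<omega>)
    = measure law {t..t + h} / (1 - measure law {..<t})"
proof -
  have "T \<omega> \<in> {ereal t .. ereal (t + h)} \<and> ereal t \<le> T \<omega> \<longleftrightarrow> T \<omega> \<in> ereal ` {t..t + h}" for \<omega>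
    by (cases "T \<omega>") auto
  then show ?thesis
    by (simp only: cond_prob_def prob_ge measure_law borel_closed closed_atLeastAtMost)
qed

text \<open>Dividing the \<open>o(h)\<close> condition by \<open>h\<close> leaves the derivative of
  \<open>1 - exp (- R t * h)\<close> at \<open>h = 0\<close>, which is \<open>R t\<close>.\<close>

lemma escape_quotient:
  assumes "u \<le> t" "measure law {..<t} < 1"
  shows "((\<lambda>h. measure law {t..t + h} / (1 - measure law {..<t}) / h) \<longlongrightarrow> R t) (at_right 0)"
proof -
  let ?q = "\<lambda>h. measure law {t..t + h} / (1 - measure law {..<t})"
  have "(\<lambda>h. ?q h - (1 - exp (- R t * h))) \<in> o[at_right 0](\<lambda>h. h)"
    using rate[OF assms(1)] assms(2) unfolding cond_prob_eq prob_ge by simp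
  from smalloD_tendsto[OF this]
  have "((\<lambda>h. (?q h - (1 - exp (- R t * h))) / h) \<longlongrightarrow> 0) (at_right 0)" .
  moreover have "((\<lambda>h. 1 - exp (- R t * h)) has_real_derivative R t) (at_right 0)"
    by (auto intro!: derivative_eq_intros)
  then have "((\<lambda>h. (1 - exp (- R t * h)) / h) \<longlongrightarrow> R t) (at_right 0)"
    by (simp add: has_field_derivative_iff)
  ultimately have "((\<lambda>h. (?q h - (1 - exp (- R t * h))) / h + (1 - exp (- R t * h)) / h)
      \<longlongrightarrow> 0 + R t) (at_right 0)"
    by (rule tendsto_add)
  then show ?thesis
    by (simp add: diff_divide_distrib)
qed

text \<open>The closed window \<open>{t..t + h}\<close> contains \<open>t\<close> for every
  \<open>h > 0\<close>, yet by the rate its mass tends to \<open>0\<close> with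
  \<open>h\<close>.\<close>

lemma law_atom:
  assumes "u \<le> t"
  shows "measure law {t} = 0"
proof (cases "measure law {..<t} < 1")
  case True
  let ?G = "1 - measure law {..<t}"
  have "((\<lambda>h. measure law {t..t + h} / ?G / h * (?G * h)) \<longlongrightarrow> R t * (?G * 0)) (at_right 0)"
    by (intro tendsto_mult escape_quotient assms True tendsto_ident_at tendsto_const)
  then have "((\<lambda>h. measure law {t..t + h} / ?G / h * (?G * h)) \<longlongrightarrow> 0) (at_right 0)"
    by simp
  moreover have "\<forall>\<^sub>F h in at_right 0. measure law {t} \<le> measure law {t..t + h} / ?G / h * (?G * h)"
    using eventually_at_right_less[of "0::real"]
  proof eventually_elim
    case (elim h)
    then have "measure law {t} \<le> measure law {t..t + h}"
      by (intro law.finite_measure_mono) auto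
    then show ?case using True elim by simp
  qed
  ultimately have "measure law {t} \<le> 0"
    by (intro tendsto_lowerbound) auto
  then show ?thesis using measure_nonneg[of law "{t}"] by linarith
next
  case False
  \<comment> \<open>All mass already lies strictly before \<open>t\<close>, so none remains for an
    atom.\<close>
  have "measure law {..<t} + measure law {t} = measure law {..t}"
    by (subst law.finite_measure_Union[symmetric]) (auto intro!: arg_cong[of _ _ "measure law"])
  also have "\<dots> \<le> 1"
    by (simp add: measure_law)
  finally show ?thesis using False measure_nonneg[of law "{t}"] by linarith
qed

lemma measure_law_lessThan:
  assumes "u \<le> t"
  shows "measure law {..<t} = cdf law t"
proof -
  have "measure law {..<t} + measure law {t} = measure law {..t}"
    by (subst law.finite_measure_Union[symmetric]) (auto intro!: arg_cong[of _ _ "measure law"])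
  then show ?thesis using law_atom[OF assms] by (simp add: cdf_def)
qed

lemma measure_law_Icc:
  assumes "u \<le> t" "0 < h"
  shows "measure law {t..t + h} = survival t - survival (t + h)"
proof -
  have "measure law {t..t + h} = measure law {t} + measure law {t<..t + h}"
    using assms
    by (subst law.finite_measure_Union[symmetric]) (auto intro!: arg_cong[of _ _ "measure law"])
  also have "\<dots> = cdf law (t + h) - cdf law t"
    using assms by (simp add: law_atom law.cdf_diff_eq)
  finally show ?thesis by (simp add: survival_def)
qed

text \<open>No mass lies before \<open>u\<close>, and the absence of an atom at \<open>u\<close>
  excludes escape at the instant of entry.\<close>

lemma survival_start: "survival u = 1"
proof -
  have "{\<omega> \<in> space M. T \<omega> \<in> ereal ` {..<u}} = {}"
    using T_ge by force
  then have "measure law {..<u} = 0"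
    by (simp only: measure_law measure_empty lessThan_borel)
  then show ?thesis by (simp add: survival_def measure_law_lessThan)
qed

lemma survival_nonneg: "0 \<le> survival t"
  by (simp add: survival_def cdf_def measure_law)

lemma survival_le_1: "survival t \<le> 1"
  by (simp add: survival_def law.cdf_nonneg)

lemma survival_antimono: "s \<le> t \<Longrightarrow> survival t \<le> survival s"
  by (simp add: survival_def law.cdf_nondecreasing)

lemma isCont_survival: "u \<le> t \<Longrightarrow> isCont survival t"
  unfolding survival_def [abs_def]
  by (intro continuous_intros) (simp add: law.isCont_cdf law_atom)

lemma continuous_on_survival: "u \<le> a \<Longrightarrow> continuous_on {a..b} survival"
  by (intro continuous_at_imp_continuous_on ballI isCont_survival) auto

text \<open>The sign of \<open>R\<close> comes from its being a limit of quotients of probabilities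
  by \<open>h > 0\<close>.\<close>

lemma rate_nonneg:
  assumes "u \<le> t" "0 < survival t"
  shows "0 \<le> R t"
proof (rule tendsto_lowerbound)
  show "((\<lambda>h. measure law {t..t + h} / (1 - measure law {..<t}) / h) \<longlongrightarrow> R t) (at_right 0)"
    using assms by (intro escape_quotient) (auto simp: measure_law_lessThan survival_def)
  show "\<forall>\<^sub>F h in at_right 0. 0 \<le> measure law {t..t + h} / (1 - measure law {..<t}) / h"
    using eventually_at_right_less[of "0::real"]
    by eventually_elim (use assms in \<open>auto simp: measure_law_lessThan survival_def\<close>)
qed simp

lemma survival_right_derivative:
  assumes "u \<le> t"
  shows "(survival has_real_derivative - (R t * survival t)) (at_right t)"
proof (cases "0 < survival t")
  case True
  have "((\<lambda>h. measure law {t..t + h} / (1 - measure law {..<t}) / h) \<longlongrightarrow> R t) (at_right 0)"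
    using assms True by (intro escape_quotient) (auto simp: measure_law_lessThan survival_def)
  then have "((\<lambda>h. - (measure law {t..t + h} / survival t / h * survival t))
      \<longlongrightarrow> - (R t * survival t)) (at_right 0)"
    using assms by (intro tendsto_intros) (simp add: measure_law_lessThan survival_def)
  moreover have "\<forall>\<^sub>F h in at_right 0. - (measure law {t..t + h} / survival t / h * survival t)
      = (survival (h + t) - survival t) / h"
    using eventually_at_right_less[of "0::real"]
  proof eventually_elim
    case (elim h)
    then show ?case
      using True by (simp add: measure_law_Icc[OF assms elim] add.commute[of h])
        (simp add: minus_divide_left)
  qed
  ultimately have "((\<lambda>h. (survival (h + t) - survival t) / h) \<longlongrightarrow> - (R t * survival t)) (at_right 0)"
    by (rule Lim_transform_eventually)
  then show ?thesis
    by (simp add: has_field_derivative_iff filterlim_at_right_to_0[of _ _ t])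
next
  case False
  \<comment> \<open>The rate condition is silent here, but \<open>survival\<close> vanishes from
    \<open>t\<close> onwards, so its right derivative is \<open>0\<close>, matching the factor
    \<open>survival t = 0\<close>.\<close>
  then have "survival s = 0" if "t \<le> s" for s
    using survival_antimono[OF that] survival_nonneg[of s] by linarith
  then have "((\<lambda>y. (survival y - survival t) / (y - t)) \<longlongrightarrow> 0) (at_right t)"
    using eventually_at_right_less[of t]
    by (intro tendsto_eventually) (auto elim: eventually_mono)
  then show ?thesis
    using \<open>\<And>s. t \<le> s \<Longrightarrow> survival s = 0\<close>[of t] by (simp add: has_field_derivative_iff)
qed

section \<open>The exponential formula for the survival function\<close>

lemma survival_eq_if_pos:
  assumes "u \<le> t" "0 < survival t"
  shows "survival t = exp (- (LBINT s:{u..t}. R s))"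
proof -
  \<comment> \<open>Positivity at \<open>t\<close> passes to all earlier times, so the logarithm can
    be used on all of \<open>{u..t}\<close>.\<close>
  have pos: "0 < survival s" if "s \<le> t" for s
    using assms survival_antimono[OF that] by linarith
  have "(LBINT s:{u..t}. - R s) = ln (survival t) - ln (survival u)"
    using assms(1)
  proof (rule right_derivative_integral)
    show "continuous_on {u..t} (\<lambda>s. ln (survival s))"
      using pos by (intro continuous_on_ln continuous_on_survival) (auto simp: less_imp_neq[symmetric])
    show "((\<lambda>s. ln (survival s)) has_real_derivative - R s) (at_right s)" if "u \<le> s" "s < t" for s
      using pos[of s] that
      by (auto intro!: derivative_eq_intros survival_right_derivative)
    show "set_integrable lborel {u..t} (\<lambda>s. - R s)"
      using R_integrable[OF assms(1)] by (simp add: set_integrable_def)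
  qed
  then have "ln (survival t) = - (LBINT s:{u..t}. R s)"
    by (simp add: survival_start set_lebesgue_integral_def)
  then show ?thesis using assms(2) by (metis exp_ln)
qed

text \<open>At a first zero \<open>z\<close> the exponential formula, valid before \<open>z\<close>,
  would contradict continuity from the left.\<close>

lemma survival_pos:
  assumes "u \<le> t"
  shows "0 < survival t"
proof (rule ccontr)
  assume "\<not> 0 < survival t"
  then have "survival t = 0" using survival_nonneg[of t] by linarith
  moreover have "compact {s \<in> {u..t}. survival s = 0}"
    unfolding compact_eq_bounded_closed
    by (intro conjI continuous_closed_preimage_constant continuous_on_survival)
       (auto intro: bounded_subset[of "{u..t}"])
  ultimately obtain z where z: "u \<le> z" "z \<le> t" "survival z = 0"
      and z_min: "\<And>s. u \<le> s \<Longrightarrow> s \<le> t \<Longrightarrow> survival s = 0 \<Longrightarrow> z \<le> s"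
    using compact_attains_inf[of "{s \<in> {u..t}. survival s = 0}"] assms by auto
  have "u < z" using z survival_start by (cases "u = z") auto
  \<comment> \<open>Taking \<open>\<bar>R s\<bar>\<close> over all of \<open>{u..t}\<close> gives
    one bound for the integrals up to every \<open>s < z\<close>.\<close>
  define K where "K = (LBINT s:{u..t}. \<bar>R s\<bar>)"
  have le: "exp (- K) \<le> survival s" if s: "u \<le> s" "s < z" for s
  proof -
    have "0 < survival s"
      using z_min[of s] s z survival_nonneg[of s] by force
    moreover have "(LBINT s:{u..s}. R s) \<le> K"
      unfolding K_def set_lebesgue_integral_def
    proof (rule integral_mono)
      show "integrable lborel (\<lambda>x. indicator {u..s} x *\<^sub>R R x)"
        using R_integrable[OF s(1)] by (simp add: set_integrable_def)
      show "integrable lborel (\<lambda>x. indicator {u..t} x *\<^sub>R \<bar>R x\<bar>)"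
        using set_integrable_abs[OF R_integrable[OF assms]] by (simp add: set_integrable_def)
    qed (use s z in \<open>auto simp: indicator_def\<close>)
    ultimately show ?thesis
      using survival_eq_if_pos[OF s(1)] by simp
  qed
  have "exp (- K) \<le> survival z"
  proof (rule tendsto_lowerbound)
    show "(survival \<longlongrightarrow> survival z) (at_left z)"
      using isCont_survival[OF z(1)] by (simp add: isCont_def filterlim_at_split)
    show "\<forall>\<^sub>F s in at_left z. exp (- K) \<le> survival s"
      unfolding eventually_at_left_field using \<open>u < z\<close> le by (intro exI[of _ u]) auto
  qed simp
  then show False using z by simp
qed

lemma survival_eq: "u \<le> t \<Longrightarrow> survival t = exp (- (LBINT s:{u..t}. R s))"
  by (simp add: survival_eq_if_pos survival_pos)

section \<open>The density of the law\<close>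

text \<open>For \<open>t < u\<close> the interval \<open>{u..t}\<close> is empty and the value is
  merely \<open>R t\<close>; the indicator of \<open>{u<..}\<close> cuts this off below.\<close>

definition hazard_density :: "real \<Rightarrow> real" where
  "hazard_density t = R t * exp (- (LBINT s:{u..t}. R s))"

lemma hazard_density_eq: "u \<le> t \<Longrightarrow> hazard_density t = R t * survival t"
  by (simp add: hazard_density_def survival_eq)

lemma hazard_density_nonneg: "u \<le> t \<Longrightarrow> 0 \<le> hazard_density t"
  by (simp add: hazard_density_eq survival_nonneg rate_nonneg survival_pos)

lemma survival_measurable [measurable]: "survival \<in> borel_measurable borel"
proof -
  have "cdf law \<in> borel_measurable borel"
    by (intro borel_measurable_mono monoI law.cdf_nondecreasing)
  then show ?thesis unfolding survival_def [abs_def] by measurable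
qed

lemma hazard_density_integrable:
  assumes "u \<le> a"
  shows "set_integrable lborel {a..b} hazard_density"
proof -
  have R_int: "set_integrable lborel {a..b} R"
  proof (cases "a \<le> b")
    case True
    then show ?thesis
      using assms by (intro set_integrable_subset[OF R_integrable[of b]]) auto
  qed (simp add: set_integrable_def)
  have [measurable]: "(\<lambda>x. indicator {a..b} x * R x) \<in> borel_measurable borel"
    using R_int by (simp add: set_integrable_def borel_measurable_integrable)
  \<comment> \<open>On \<open>{a..b}\<close> the exponential is replaced by \<open>survival\<close>,
    which is measurable by monotonicity and lies between 0 and 1.\<close>
  have "integrable lborel (\<lambda>x. (indicator {a..b} x * R x) * survival x)"
  proof (rule Bochner_Integration.integrable_bound)
    show "integrable lborel (\<lambda>x. indicator {a..b} x * R x)"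
      using R_int by (simp add: set_integrable_def)
    show "AE x in lborel. norm ((indicator {a..b} x * R x) * survival x)
        \<le> norm (indicator {a..b} x * R x)"
      by (intro AE_I2)
         (simp add: abs_mult survival_nonneg survival_le_1 mult_left_le)
  qed measurable
  also have "(\<lambda>x. (indicator {a..b} x * R x) * survival x) = (\<lambda>x. indicator {a..b} x *\<^sub>R hazard_density x)"
    using assms by (auto simp: indicator_def hazard_density_eq)
  finally show ?thesis by (simp add: set_integrable_def)
qed

text \<open>The antiderivative is \<open>- survival\<close>, whose right derivative is known at
  every point from the rate; this avoids differentiating the integral of \<open>R\<close>.\<close>

lemma integral_hazard_density:
  assumes "u \<le> a" "a \<le> b"
  shows "(LBINT t:{a..b}. hazard_density t) = survival a - survival b"
proof -
  have "(LBINT t:{a..b}. hazard_density t) = - survival b - (- survival a)"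
    using assms(2)
  proof (rule right_derivative_integral)
    show "((\<lambda>t. - survival t) has_real_derivative hazard_density t) (at_right t)" if "a \<le> t" for t
      using assms that by (auto intro!: derivative_eq_intros survival_right_derivative simp: hazard_density_eq)
  qed (auto intro!: continuous_intros continuous_on_survival hazard_density_integrable assms)
  then show ?thesis by simp
qed

text \<open>Integrability is only local, so measurability on \<open>{u<..}\<close> is obtained from
  bounded intervals by a pointwise limit.\<close>

lemma hazard_density_measurable [measurable]: "(\<lambda>t. indicator {u<..} t * hazard_density t) \<in> borel_measurable borel"
proof (rule borel_measurable_LIMSEQ_real)
  show "(\<lambda>t. indicator {u<..} t * (indicator {u..u + real n} t * hazard_density t)) \<in> borel_measurable borel" for n
  proof -
    have meas: "(\<lambda>t. indicator {u..u + real n} t * hazard_density t) \<in> borel_measurable borel"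
      using borel_measurable_integrable[OF hazard_density_integrable[of u "u + real n", unfolded set_integrable_def]]
      by simp
    show ?thesis
      by (rule borel_measurable_times[OF borel_measurable_indicator meas]) simp
  qed
  show "(\<lambda>n. indicator {u<..} t * (indicator {u..u + real n} t * hazard_density t))
      \<longlonglongrightarrow> indicator {u<..} t * hazard_density t" for t
  proof (rule tendsto_eventually)
    obtain n0 where "t - u \<le> real n0" using real_arch_simple by blast
    then show "\<forall>\<^sub>F n in sequentially. indicator {u<..} t * (indicator {u..u + real n} t * hazard_density t)
        = indicator {u<..} t * hazard_density t"
      by (intro eventually_sequentiallyI[of n0]) (auto simp: indicator_def)
  qed
qed

text \<open>It suffices to compare rays \<open>{x<..}\<close>. Bounded intervals are settled by the
  integral formula, rays from \<open>a \<ge> u\<close> by exhaustion, and for \<open>x < u\<close>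
  neither measure charges \<open>{x<..u}\<close>.\<close>

lemma law_eq_density: "law = density lborel (\<lambda>t. ennreal (indicator {u<..} t * hazard_density t))"
proof (rule measure_eqI_lessThan)
  let ?N = "density lborel (\<lambda>t. ennreal (indicator {u<..} t * hazard_density t))"
  have emeasure_N: "emeasure ?N A
      = (\<integral>\<^sup>+t. ennreal (indicator {u<..} t * hazard_density t) * indicator A t \<partial>lborel)"
    if "A \<in> sets borel" for A
    using that by (intro emeasure_density) auto
  have Ioc: "emeasure law {a<..b} = emeasure ?N {a<..b}" if a: "u \<le> a" "a \<le> b" for a b
  proof -
    have "emeasure ?N {a<..b}
        = (\<integral>\<^sup>+t. ennreal (indicator {u<..} t * hazard_density t) * indicator {a<..b} t \<partial>lborel)"
      by (intro emeasure_N) simp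
    \<comment> \<open>The endpoint \<open>a\<close> is a null set; removing it also absorbs the
      indicator of \<open>{u<..}\<close> when \<open>a = u\<close>.\<close>
    also have "\<dots> = (\<integral>\<^sup>+t. ennreal (indicator {a..b} t * hazard_density t) \<partial>lborel)"
      by (intro nn_integral_cong_AE eventually_mono[OF AE_lborel_singleton[of a]])
         (use a in \<open>auto simp: indicator_def\<close>)
    also have "\<dots> = ennreal (LBINT t:{a..b}. hazard_density t)"
      unfolding set_lebesgue_integral_def
      using hazard_density_integrable[OF a(1), of b] a
      by (subst nn_integral_eq_integral) (auto simp: set_integrable_def indicator_def hazard_density_nonneg)
    also have "\<dots> = ennreal (cdf law b - cdf law a)"
      using a by (simp add: integral_hazard_density survival_def)
    also have "\<dots> = emeasure law {a<..b}"
      using a by (cases "a = b") (auto simp: law.cdf_diff_eq law.emeasure_eq_measure)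
    finally show ?thesis by simp
  qed
  have Ioi: "emeasure law {a<..} = emeasure ?N {a<..}" if a: "u \<le> a" for a
  proof (rule LIMSEQ_unique)
    have Un: "(\<Union>n. {a<..a + real n}) = {a<..}"
      by (auto simp: algebra_simps) (metis add.commute diff_le_eq real_arch_simple)
    have "(\<lambda>n. emeasure law {a<..a + real n}) \<longlonglongrightarrow> emeasure law (\<Union>n. {a<..a + real n})"
      by (rule Lim_emeasure_incseq) (auto simp: incseq_def)
    then show "(\<lambda>n. emeasure law {a<..a + real n}) \<longlonglongrightarrow> emeasure law {a<..}"
      unfolding Un .
    have "(\<lambda>n. emeasure ?N {a<..a + real n}) \<longlonglongrightarrow> emeasure ?N (\<Union>n. {a<..a + real n})"
      by (rule Lim_emeasure_incseq) (auto simp: incseq_def)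
    then show "(\<lambda>n. emeasure law {a<..a + real n}) \<longlonglongrightarrow> emeasure ?N {a<..}"
      unfolding Un using a by (simp add: Ioc)
  qed
  show "emeasure law {x<..} = emeasure ?N {x<..}" for x
  proof (cases "u \<le> x")
    case False
    have "emeasure law {x<..u} \<le> emeasure law {..u}"
      by (intro emeasure_mono) auto
    also have "\<dots> = 0"
      using survival_start by (simp add: survival_def cdf_def law.emeasure_eq_measure)
    finally have "emeasure law {x<..u} = 0" by simp
    then have "emeasure law {x<..} = emeasure law {u<..}"
      using False
      by (subst emeasure_Un_null_set[of "{u<..}" law "{x<..u}", symmetric])
         (auto simp: null_sets_def intro!: arg_cong[of _ _ "emeasure law"])
    also have "\<dots> = emeasure ?N {u<..}" by (simp add: Ioi)
    also have "\<dots> = emeasure ?N {x<..}"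
      using False by (subst (1 2) emeasure_N) (auto simp: indicator_def intro!: nn_integral_cong)
    finally show ?thesis .
  qed (rule Ioi)
qed (auto simp: law.emeasure_eq_measure)

end

section \<open>Escape times of the particle\<close>

text \<open>Since a label persists for a while to the right of each time, a visit to
  \<open>j\<close> before \<open>x\<close> is also seen at a rational time, which leaves a countable
  union of events.\<close>

lemma escape_time_measurable:
  assumes "enters_well M Y i u"
  shows "escape_time Y j u \<in> borel_measurable M"
proof (rule borel_measurableI_less)
  fix x :: ereal
  have "escape_time Y j u \<omega> < x \<longleftrightarrow> (\<exists>q\<in>{q \<in> \<rat>. u < q \<and> ereal q < x}. Y q \<omega> = j)"
    if \<omega>: "\<omega> \<in> space M" for \<omega>
  proof
    assume "escape_time Y j u \<omega> < x"
    then obtain t where t: "u < t" "Y t \<omega> = j" "ereal t < x"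
      by (auto simp: escape_time_def Inf_less_iff)
    have "\<forall>\<^sub>F s in at_right t. Y s \<omega> = Y t \<omega>"
      using assms \<omega> t(1) by (auto simp: enters_well_def)
    then obtain b where b: "t < b" "\<And>s. t < s \<Longrightarrow> s < b \<Longrightarrow> Y s \<omega> = Y t \<omega>"
      by (auto simp: eventually_at_right_field)
    \<comment> \<open>The intermediate point is taken in \<open>ereal\<close> because
      \<open>x\<close> may be \<open>\<infinity>\<close>; lying between \<open>ereal t\<close> and
      \<open>ereal b\<close>, it is real.\<close>
    obtain y where y: "ereal t < y" "y < min (ereal b) x"
      using dense[of "ereal t" "min (ereal b) x"] t b by auto
    then obtain r where "y = ereal r" by (cases y) auto
    with y obtain q where "q \<in> \<rat>" "t < q" "q < r"
      using Rats_dense_in_real[of t r] by auto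
    with y \<open>y = ereal r\<close> b t show "\<exists>q\<in>{q \<in> \<rat>. u < q \<and> ereal q < x}. Y q \<omega> = j"
      by (intro bexI[of _ q]) (auto intro: less_trans[of "ereal q" "ereal r" x])
  qed (auto simp: escape_time_def Inf_less_iff)
  then have "{\<omega> \<in> space M. escape_time Y j u \<omega> < x}
      = (\<Union>q\<in>{q \<in> \<rat>. u < q \<and> ereal q < x}. {\<omega> \<in> space M. Y q \<omega> = j})"
    by auto
  also have "\<dots> \<in> sets M"
  proof (intro sets.countable_UN'' countable_subset[OF _ countable_rat])
    fix q assume "q \<in> {q \<in> \<rat>. u < q \<and> ereal q < x}"
    then have [measurable]: "Y q \<in> measurable M (count_space UNIV)"
      using assms by (auto simp: enters_well_def)
    show "{\<omega> \<in> space M. Y q \<omega> = j} \<in> sets M" by measurable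
  qed auto
  finally show "{\<omega> \<in> space M. escape_time Y j u \<omega> < x} \<in> sets M" .
qed

lemma escape_time_ge: "ereal u \<le> escape_time Y j u \<omega>"
  by (auto simp: escape_time_def intro!: Inf_greatest)

lemma escape_time_density_of_rate:
  assumes "enters_well M Y i u" "has_escape_rate M Y j u R"
  shows "escape_time_density M Y j u (\<lambda>t. R t * exp (- (LBINT s:{u..t}. R s)))"
proof -
  let ?T = "escape_time Y j u"
  interpret hazard_rate M ?T u R
    using assms
    by (intro hazard_rate.intro hazard_rate_axioms.intro escape_time_measurable)
       (auto simp: enters_well_def has_escape_rate_def escape_time_ge)
  have law_A: "emeasure law A = (\<integral>\<^sup>+t\<in>A. ennreal (hazard_density t) \<partial>lborel)"
    if "A \<in> sets borel" "A \<subseteq> {u<..}" for A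
    unfolding law_eq_density using that
    by (subst emeasure_density)
       (use hazard_density_measurable in \<open>auto intro!: nn_integral_cong simp: indicator_def\<close>)
  have distr: "distributed M lborel (\<lambda>\<omega>. real_of_ereal (?T \<omega>)) (\<lambda>t. ennreal (indicator {u<..} t * hazard_density t))"
    if fin: "AE \<omega> in M. ?T \<omega> < \<infinity>"
  proof -
    have "distr M lborel (\<lambda>\<omega>. real_of_ereal (?T \<omega>)) = law"
    proof (rule measure_eqI)
      fix A assume "A \<in> sets (distr M lborel (\<lambda>\<omega>. real_of_ereal (?T \<omega>)))"
      then have A [measurable]: "A \<in> sets borel" by simp
      have "emeasure (distr M lborel (\<lambda>\<omega>. real_of_ereal (?T \<omega>))) A
          = emeasure M {\<omega> \<in> space M. real_of_ereal (?T \<omega>) \<in> A}"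
        by (subst emeasure_distr) (auto intro!: arg_cong[of _ _ "emeasure M"])
      \<comment> \<open>Almost sure finiteness makes the value \<open>0\<close> of
        \<open>real_of_ereal\<close> at \<open>\<infinity>\<close> irrelevant.\<close>
      also have "\<dots> = emeasure M {\<omega> \<in> space M. ?T \<omega> < \<infinity> \<and> real_of_ereal (?T \<omega>) \<in> A}"
        using fin by (intro emeasure_eq_AE) (auto elim: eventually_mono)
      also have "\<dots> = emeasure law A"
        by (simp add: emeasure_law mem_ereal_image_iff cong: conj_cong)
      finally show "emeasure (distr M lborel (\<lambda>\<omega>. real_of_ereal (?T \<omega>))) A = emeasure law A" .
    qed simp
    then show ?thesis
      by (simp add: distributed_def law_eq_density)
  qed
  have "escape_time_density M Y j u hazard_density"
    unfolding escape_time_density_def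
    using distr law_A hazard_density_nonneg T_measurable
    by (auto simp: set_borel_measurable_def emeasure_law)
  then show ?thesis by (simp add: hazard_density_def [abs_def])
qed

theorem theorem3p5:
  fixes P_left P_right :: "'a measure"
    and Y :: "real \<Rightarrow> 'a \<Rightarrow> int"
    and R_left_right R_right_left :: "real \<Rightarrow> real"
    and u :: real
  assumes "enters_well P_left Y (-1) u"
    and "enters_well P_right Y 1 u"
    and "has_escape_rate P_left Y 1 u R_left_right"
    and "has_escape_rate P_right Y (-1) u R_right_left"
  shows "escape_time_density P_left Y 1 u
           (\<lambda>t. R_left_right t * exp (- (LBINT s:{u..t}. R_left_right s)))
  \<and> escape_time_density P_right Y (-1) u
           (\<lambda>t. R_right_left t * exp (- (LBINT s:{u..t}. R_right_left s)))"
  using assms by (blast intro: escape_time_density_of_rate)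

end
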